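(* For each positive integer $d$ with $4 \mid d$ and each even integer $n$ with $n \ge d + 4$, there exists a $d$-regular Cayley nut graph of order $n$ (that is, a graph on $n$ vertices that is $d$-regular, is a Cayley graph of some finite group, and is a nut graph).
   Context: All graphs are simple and finite. A nut graph is a non-trivial simple graph (i.e. with at least two vertices) whose $(0,1)$-adjacency matrix has a one-dimensional null space (over $\mathbb{R}$) spanned by a full vector, i.e. a vector with no zero entries. A Cayley graph of a finite group $\Gamma$ is a graph with vertex set $\Gamma$ in which $x,y$ are adjacent if and only if $x^{-1}y \in S$, where $S \subseteq \Gamma$ is an inverse-closed subset not containing the identity. *)

theory Defs
  imports "Graph_Theory.Pair_Digraph" "Jordan_Normal_Form.Matrix_Kernel"
begin

definition regular_graph :: "nat \<Rightarrow> 'a pair_pre_digraph \<Rightarrow> bool" where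
  "regular_graph d G \<longleftrightarrow> pair_graph G \<and> (\<forall>v\<in>pverts G. out_degree (with_proj G) v = d)"

definition cayley_graph :: "('a, 'b) monoid_scheme \<Rightarrow> 'a set \<Rightarrow> 'a pair_pre_digraph" where
  "cayley_graph \<Gamma> S =
     \<lparr>pverts = carrier \<Gamma>,
      parcs = {(x, y) \<in> carrier \<Gamma> \<times> carrier \<Gamma>. inv\<^bsub>\<Gamma>\<^esub> x \<otimes>\<^bsub>\<Gamma>\<^esub> y \<in> S}\<rparr>"

text \<open>The group is placed directly on the vertex set. This is no restriction compared with asking
  for an isomorphism to a Cayley graph, since the group structure can be transported along it.\<close>

definition is_cayley_graph :: "'a pair_pre_digraph \<Rightarrow> bool" where
  "is_cayley_graph G \<longleftrightarrow>
     (\<exists>(\<Gamma> :: 'a monoid) S.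
        group \<Gamma> \<and> finite (carrier \<Gamma>) \<and>
        S \<subseteq> carrier \<Gamma> \<and> \<one>\<^bsub>\<Gamma>\<^esub> \<notin> S \<and> (\<forall>s\<in>S. inv\<^bsub>\<Gamma>\<^esub> s \<in> S) \<and>
        G = cayley_graph \<Gamma> S)"

definition adjacency_matrix :: "'a pair_pre_digraph \<Rightarrow> 'a list \<Rightarrow> real mat" where
  "adjacency_matrix G vs =
     mat (length vs) (length vs) (\<lambda>(i, j). if (vs ! i, vs ! j) \<in> parcs G then 1 else 0)"

definition full_vec :: "real vec \<Rightarrow> bool" where
  "full_vec x \<longleftrightarrow> (\<forall>i < dim_vec x. x $ i \<noteq> 0)"

text \<open>The list \<open>vs\<close> enumerates the vertices. Another enumeration permutes the coordinates of the
  null space, so the choice is immaterial.\<close>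

definition nut_graph :: "'a pair_pre_digraph \<Rightarrow> bool" where
  "nut_graph G \<longleftrightarrow>
     pair_graph G \<and> card (pverts G) \<ge> 2 \<and>
     (\<exists>vs. distinct vs \<and> set vs = pverts G \<and>
        kernel_dim (adjacency_matrix G vs) = 1 \<and>
        (\<exists>x \<in> mat_kernel (adjacency_matrix G vs). full_vec x \<and>
           mat_kernel (adjacency_matrix G vs) =
             LinearCombinations.module.span class_ring (module_vec TYPE(real) (length vs)) {x}))"

end

theory Submission
  imports Defs
begin

text \<open>Write \<open>n = 2m\<close>, \<open>d = 2k\<close>, \<open>k = 2q\<close>, and take a Cayley graph of the dihedral group of order
  \<open>2m\<close> whose connection set consists of \<open>k\<close> rotations \<open>R\<close> and \<open>k\<close> reflections \<open>F\<close>, viewed as sets of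
  integers modulo \<open>m\<close>. A null vector is a pair of \<open>m\<close>-periodic sequences \<open>v0, v1\<close> with
  \<open>R v0 + F v1 = 0\<close> and \<open>F' v0 + R v1 = 0\<close>, where sets act by summing over shifts and \<open>F' = -F\<close>;
  since \<open>|R| = |F|\<close>, the vector that is \<open>1\<close> on rotations and \<open>-1\<close> on reflections is one. The sets are
  chosen so that there are no others:

  \<^item> \<open>m\<close> odd, or \<open>m\<close> twice an odd number: \<open>R = Y \<union> A\<close> and \<open>F = Y \<union> B\<close> are symmetric, with
    two-element sets \<open>A, B\<close>. Then \<open>v0 - v1\<close> lies in the kernel of \<open>R - F = A - B\<close>, which consists of
    the constants, and \<open>v0 + v1\<close> in that of \<open>R + F\<close>, which is congruent to \<open>A + B\<close> modulo 2 whatever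
    \<open>Y\<close> is. An integer kernel vector with an odd entry is excluded by its parity pattern.

  \<^item> \<open>4\<close> divides \<open>m\<close>, \<open>q \<ge> 2\<close>: with \<open>x\<close> the shift, \<open>F = U - x\<close> and \<open>R = U - 1\<close>, so that
    \<open>F F' - R R = U (2 - x - 1/x)\<close>. Here \<open>R\<close> is invariant under translation by \<open>m/2\<close>, and
    \<open>U\<close> is invertible: an integer vector killed by \<open>U\<close> is invariant under that translation, and on
    such vectors \<open>U\<close> is the identity modulo 2.

  \<^item> \<open>4\<close> divides \<open>m\<close>, \<open>q = 1\<close>: \<open>R = {m/4, 3m/4}\<close> and \<open>F = {0, 1}\<close>.\<close>

section \<open>Periodic sequences\<close>

lemma periodic_add_mult:
  fixes f :: "int \<Rightarrow> 'a"
  assumes per: "\<And>i. f (i + m) = f i"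
  shows "f (i + k * m) = f i"
proof (induction k arbitrary: i rule: int_induct[where k = 0])
  case (step1 k)
  have "f (i + (k + 1) * m) = f ((i + k * m) + m)" by (simp add: algebra_simps)
  then show ?case using step1 per by simp
next
  case (step2 k)
  have "f (i + (k - 1) * m) = f ((i + (k - 1) * m) + m)" using per by simp
  also have "\<dots> = f (i + k * m)" by (simp add: algebra_simps)
  finally show ?case using step2 by simp
qed simp

lemma periodic_cong:
  fixes f :: "int \<Rightarrow> 'a"
  assumes per: "\<And>i. f (i + m) = f i" and "m dvd i - j"
  shows "f i = f j"
proof -
  obtain k where "i - j = m * k" using assms(2) by blast
  then have "i = j + k * m" by (simp add: algebra_simps)
  then show ?thesis using periodic_add_mult[of f m j k, OF per] by simp
qed

text \<open>By Bezout, 1 is an integer combination of the two periods, hence itself a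
  period.\<close>

lemma periodic_coprime_const:
  fixes f :: "int \<Rightarrow> 'a"
  assumes "\<And>i. f (i + a) = f i" "\<And>i. f (i + m) = f i" "coprime a m"
  shows "f i = f j"
proof -
  obtain u v where uv: "u * a + v * m = 1"
    using bezout_int[of a m] assms(3) by (metis coprime_imp_gcd_eq_1)
  have "f (i + 1) = f i" for i
  proof -
    have "f (i + 1) = f ((i + u * a) + v * m)" by (simp add: uv[symmetric] algebra_simps)
    also have "\<dots> = f i" using periodic_add_mult[of f, OF assms(1)] periodic_add_mult[of f, OF assms(2)] by metis
    finally show ?thesis .
  qed
  from periodic_cong[of f 1, OF this] show ?thesis by simp
qed

text \<open>Over one period the increments add up to \<open>m * c\<close>, which periodicity forces
  to be 0.\<close>

lemma periodic_arith_const: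
  fixes f :: "int \<Rightarrow> real"
  assumes per: "\<And>i. f (i + m) = f i" and "m > 0" and step: "\<And>i. f (i + 1) - f i = c"
  shows "f i = f j"
proof -
  have *: "f (i + int n) = f i + real n * c" for i n
  proof (induction n)
    case (Suc n)
    have "f (i + int (Suc n)) = f (i + int n) + c"
      using step[of "i + int n"] by (simp add: algebra_simps)
    then show ?case using Suc by (simp add: algebra_simps)
  qed simp
  from *[of 0 "nat m"] have "c = 0" using per[of 0] \<open>m > 0\<close> by simp
  then have "f (i + 1) = f i" for i using step[of i] by simp
  from periodic_cong[of f 1, OF this] show ?thesis by simp
qed

lemma sum_period_shift:
  fixes f :: "int \<Rightarrow> 'a :: comm_monoid_add"
  assumes per: "\<And>i. f (i + m) = f i" and "m > 0"
  shows "(\<Sum>i\<in>{0..<m}. f (i + s)) = (\<Sum>i\<in>{0..<m}. f i)"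
proof (rule sum.reindex_bij_witness[where i = "\<lambda>i. (i - s) mod m" and j = "\<lambda>i. (i + s) mod m"])
  fix a assume "a \<in> {0..<m}"
  then show "((a + s) mod m - s) mod m = a" "((a - s) mod m + s) mod m = a"
    by (simp_all add: mod_simps)
  show "f ((a + s) mod m) = f (a + s)"
    by (rule periodic_cong[of f m, OF per]) (simp add: mod_eq_dvd_iff[symmetric])
qed (use \<open>m > 0\<close> in auto)

lemma odd_sum_iff_odd_card:
  fixes f :: "'b \<Rightarrow> int"
  assumes "finite A" "\<And>a. a \<in> A \<Longrightarrow> odd (f a)"
  shows "odd (sum f A) \<longleftrightarrow> odd (card A)"
  using assms by (induction A rule: finite_induct) auto

lemma sum_symmetric:
  fixes f :: "int \<Rightarrow> 'a :: comm_monoid_add"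
  assumes "\<And>r. r \<in> R \<Longrightarrow> - r \<in> R"
  shows "(\<Sum>r\<in>R. f (i - r)) = (\<Sum>r\<in>R. f (i + r))"
  by (rule sum.reindex_bij_witness[where i = uminus and j = uminus]) (use assms in auto)

text \<open>The circulant integer matrix \<open>M\<close> below is singular over the reals, hence over the integers, and
  dividing an integer kernel vector by the gcd of its entries makes some entry odd.\<close>

lemma integer_kernel_vector:
  fixes w :: "int \<Rightarrow> real" and g :: "'b \<Rightarrow> int"
  assumes per: "\<And>i. w (i + m) = w i" and "m > 0" and S: "finite S"
    and ker: "\<And>i. (\<Sum>s\<in>S. w (i + g s)) = 0" and nz: "w a \<noteq> 0"
  obtains u :: "int \<Rightarrow> int" and b where
    "\<And>i. u (i + m) = u i" "\<And>i. (\<Sum>s\<in>S. u (i + g s)) = 0" "odd (u b)"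
proof -
  define N where "N = nat m"
  have m: "m = int N" and N: "N > 0" using \<open>m > 0\<close> by (auto simp: N_def)
  define t where "t i s = nat ((int i + g s) mod m)" for i s
  have t: "t i s < N" for i s using \<open>m > 0\<close> by (simp add: t_def m zless_nat_conj nat_less_iff)
  \<comment> \<open>Row \<open>i\<close> records where the shifts of \<open>i\<close> land. Entries
    count rather than indicate, since distinct elements of \<open>S\<close> may shift by the same
    residue.\<close>
  define M :: "int mat" where "M = mat N N (\<lambda>(i, j). \<Sum>s\<in>{s\<in>S. t i s = j}. 1)"
  have M: "M \<in> carrier_mat N N" by (simp add: M_def)
  \<comment> \<open>Polymorphic in the ring: it serves the real vector \<open>w\<close> here and the
    integer vector \<open>x\<close> below.\<close>
  have regroup: "(\<Sum>j\<in>{0..<N}. (\<Sum>s\<in>{s\<in>S. t i s = j}. 1) * f j) = (\<Sum>s\<in>S. f (t i s))"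
    for f :: "nat \<Rightarrow> 'c :: comm_ring_1" and i
  proof -
    have "(\<Sum>j\<in>{0..<N}. (\<Sum>s\<in>{s\<in>S. t i s = j}. 1) * f j)
      = (\<Sum>j\<in>{0..<N}. \<Sum>s\<in>{s\<in>S. t i s = j}. f (t i s))"
      by (intro sum.cong refl) (simp add: sum_distrib_right del: sum_constant)
    also have "\<dots> = (\<Sum>s\<in>S. f (t i s))"
      by (rule sum.group) (use S t in auto)
    finally show ?thesis .
  qed
  define v where "v = vec N (\<lambda>i. w (int i))"
  have wt: "w (int (t i s)) = w (int i + g s)" for i s
    using \<open>m > 0\<close> by (intro periodic_cong[of w m, OF per]) (simp add: t_def mod_eq_dvd_iff[symmetric])
  have "map_mat real_of_int M *\<^sub>v v = 0\<^sub>v N"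
  proof (rule eq_vecI)
    fix i assume i: "i < dim_vec (0\<^sub>v N :: real vec)"
    have "(map_mat real_of_int M *\<^sub>v v) $ i
      = (\<Sum>j\<in>{0..<N}. (\<Sum>s\<in>{s\<in>S. t i s = j}. 1) * w (int j))"
      using i by (simp add: M_def v_def scalar_prod_def del: sum_constant)
    also have "\<dots> = 0" using ker[of "int i"] by (simp only: regroup wt)
    finally show "(map_mat real_of_int M *\<^sub>v v) $ i = 0\<^sub>v N $ i" using i by simp
  qed (simp add: M_def)
  moreover have "v \<noteq> 0\<^sub>v N"
  proof
    assume "v = 0\<^sub>v N"
    then have "v $ nat (a mod m) = 0" using \<open>m > 0\<close> by (simp add: m nat_less_iff)
    moreover have "w (a mod m) = w a"
      by (intro periodic_cong[of w m, OF per]) (simp add: mod_eq_dvd_iff[symmetric])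
    ultimately show False using nz \<open>m > 0\<close> by (simp add: v_def m nat_less_iff)
  qed
  moreover have "v \<in> carrier_vec N" by (simp add: v_def)
  ultimately have "det (map_mat real_of_int M) = 0"
    using det_0_iff_vec_prod_zero[of "map_mat real_of_int M" N] M by auto
  \<comment> \<open>The determinant commutes with the embedding of the integers into the reals, so
    singularity descends to the integer matrix.\<close>
  then have "det M = 0" by simp
  then obtain x where x: "x \<in> carrier_vec N" "x \<noteq> 0\<^sub>v N" "M *\<^sub>v x = 0\<^sub>v N"
    using det_0_iff_vec_prod_zero[OF M] by blast
  define d where "d = Gcd (set\<^sub>v x)"
  have xd: "d dvd x $ i" if "i < N" for i
    using that x(1) unfolding d_def by (intro Gcd_dvd) (auto simp: vec_setI)
  have "d \<noteq> 0"
  proof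
    assume "d = 0"
    then have "x $ i = 0" if "i < N" for i using xd[OF that] by simp
    then have "x = 0\<^sub>v N" using x(1) by (intro eq_vecI) auto
    then show False using x(2) by simp
  qed
  define u where "u i = x $ nat (i mod m) div d" for i
  have idx: "nat (i mod m) < N" for i using \<open>m > 0\<close> by (simp add: m nat_less_iff)
  have du: "d * u i = x $ nat (i mod m)" for i using xd[OF idx] by (simp add: u_def)
  show thesis
  proof (rule that)
    show "u (i + m) = u i" for i by (simp add: u_def)
    show "(\<Sum>s\<in>S. u (i + g s)) = 0" for i
    proof -
      let ?i = "nat (i mod m)"
      have "nat ((i + g s) mod m) = t ?i s" for s
        using \<open>m > 0\<close> by (simp add: t_def mod_simps)
      then have "d * (\<Sum>s\<in>S. u (i + g s)) = (\<Sum>s\<in>S. x $ t ?i s)"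
        by (simp add: sum_distrib_left du)
      also have "\<dots> = (\<Sum>j\<in>{0..<N}. (\<Sum>s\<in>{s\<in>S. t ?i s = j}. 1) * x $ j)"
        by (simp only: regroup)
      also have "\<dots> = (M *\<^sub>v x) $ ?i"
        using idx[of i] x(1) by (simp add: M_def scalar_prod_def del: sum_constant)
      finally show ?thesis using x(3) idx[of i] \<open>d \<noteq> 0\<close> by simp
    qed
    \<comment> \<open>If all values of \<open>u\<close> were even, \<open>2 * d\<close> would divide
      every entry of \<open>x\<close>, hence their gcd \<open>d\<close>.\<close>
    show "odd (u (SOME b. odd (u b)))"
    proof (rule someI_ex, rule ccontr)
      assume "\<nexists>b. odd (u b)"
      then have "2 * d dvd y" if "y \<in> set\<^sub>v x" for y
      proof -
        from that x(1) obtain i where i: "i < N" "y = x $ i" by (auto simp: vec_set_def)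
        then have "y = d * u (int i)" by (simp add: du m)
        moreover have "even (u (int i))" using \<open>\<nexists>b. odd (u b)\<close> by blast
        ultimately show ?thesis by (simp add: mult.commute[of 2])
      qed
      then have "2 * d dvd d" unfolding d_def by (intro Gcd_greatest) (auto simp: d_def)
      then show False using \<open>d \<noteq> 0\<close> zdvd_imp_le[of "2 * \<bar>d\<bar>" "\<bar>d\<bar>"] by simp
    qed
  qed
qed

section \<open>Symmetric connection sets\<close>

text \<open>\<open>v0\<close> and \<open>v1\<close> hold the values of a vector at the rotations r^i
  and the reflections r^i s. The two equations are the rows of the adjacency matrix at r^i and at
  r^i s; the second subtracts the shifts because s inverts rotations.\<close>

definition alternating_kernel :: "int \<Rightarrow> int set \<Rightarrow> int set \<Rightarrow> bool" where
  "alternating_kernel m R F \<longleftrightarrow> (\<forall>v0 v1 :: int \<Rightarrow> real.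
     (\<forall>i. v0 (i + m) = v0 i) \<longrightarrow> (\<forall>i. v1 (i + m) = v1 i) \<longrightarrow>
     (\<forall>i. (\<Sum>r\<in>R. v0 (i + r)) + (\<Sum>f\<in>F. v1 (i + f)) = 0) \<longrightarrow>
     (\<forall>i. (\<Sum>f\<in>F. v0 (i - f)) + (\<Sum>r\<in>R. v1 (i - r)) = 0) \<longrightarrow>
     (\<exists>c. \<forall>i. v0 i = c \<and> v1 i = - c))"

text \<open>The shifts are indexed by the disjoint sum \<open>R <+> F\<close>, so that one lying in
  both sets counts twice.\<close>

lemma integer_kernel_vector2:
  fixes w :: "int \<Rightarrow> real"
  assumes per: "\<And>i. w (i + m) = w i" and "m > 0" and fin: "finite R" "finite F"
    and ker: "\<And>i. (\<Sum>r\<in>R. w (i + r)) + (\<Sum>f\<in>F. w (i + f)) = 0" and nz: "w a \<noteq> 0"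
  shows "\<exists>(u :: int \<Rightarrow> int) b. (\<forall>i. u (i + m) = u i) \<and>
    (\<forall>i. (\<Sum>r\<in>R. u (i + r)) + (\<Sum>f\<in>F. u (i + f)) = 0) \<and> odd (u b)"
proof -
  let ?g = "case_sum id id"
  have split: "(\<Sum>s\<in>R <+> F. x (i + ?g s)) = (\<Sum>r\<in>R. x (i + r)) + (\<Sum>f\<in>F. x (i + f))"
    for x :: "int \<Rightarrow> 'c :: comm_monoid_add" and i
    by (subst sum.Plus[OF fin]) simp
  have "finite (R <+> F)" using fin by simp
  moreover have "(\<Sum>s\<in>R <+> F. w (i + ?g s)) = 0" for i using ker[of i] by (simp only: split)
  ultimately obtain u :: "int \<Rightarrow> int" and b where "\<And>i. u (i + m) = u i"
    "\<And>i. (\<Sum>s\<in>R <+> F. u (i + ?g s)) = 0" "odd (u b)"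
    using integer_kernel_vector[of w m "R <+> F" ?g a, OF per \<open>m > 0\<close> _ _ nz] by metis
  then have "(\<forall>i. u (i + m) = u i) \<and> (\<forall>i. (\<Sum>r\<in>R. u (i + r)) + (\<Sum>f\<in>F. u (i + f)) = 0) \<and> odd (u b)"
    by (simp only: split) simp
  then show ?thesis by blast
qed

text \<open>If \<open>R\<close> and \<open>F\<close> are symmetric, the sum and the difference of the two halves of a null
  vector decouple.\<close>

lemma alternating_kernel_symmetric:
  assumes R: "\<And>(v :: int \<Rightarrow> real) i. (\<And>j. v (j + m) = v j) \<Longrightarrow> (\<Sum>r\<in>R. v (i - r)) = (\<Sum>r\<in>R. v (i + r))"
    and F: "\<And>(v :: int \<Rightarrow> real) i. (\<And>j. v (j + m) = v j) \<Longrightarrow> (\<Sum>f\<in>F. v (i - f)) = (\<Sum>f\<in>F. v (i + f))"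
    and plus: "\<And>z :: int \<Rightarrow> real. (\<And>j. z (j + m) = z j) \<Longrightarrow>
      (\<And>i. (\<Sum>r\<in>R. z (i + r)) + (\<Sum>f\<in>F. z (i + f)) = 0) \<Longrightarrow> \<forall>i. z i = 0"
    and minus: "\<And>w :: int \<Rightarrow> real. (\<And>j. w (j + m) = w j) \<Longrightarrow>
      (\<And>i. (\<Sum>r\<in>R. w (i + r)) = (\<Sum>f\<in>F. w (i + f))) \<Longrightarrow> \<forall>i. w i = w 0"
  shows "alternating_kernel m R F"
  unfolding alternating_kernel_def
proof (intro allI impI)
  fix v0 v1 :: "int \<Rightarrow> real"
  assume per: "\<forall>i. v0 (i + m) = v0 i" "\<forall>i. v1 (i + m) = v1 i"
    and eq1: "\<forall>i. (\<Sum>r\<in>R. v0 (i + r)) + (\<Sum>f\<in>F. v1 (i + f)) = 0"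
    and eq2: "\<forall>i. (\<Sum>f\<in>F. v0 (i - f)) + (\<Sum>r\<in>R. v1 (i - r)) = 0"
  have eq2': "(\<Sum>f\<in>F. v0 (i + f)) + (\<Sum>r\<in>R. v1 (i + r)) = 0" for i
    using spec[OF eq2, of i] F[of v0 i] R[of v1 i] per by simp
  have "\<forall>i. v0 i + v1 i = 0"
  proof (rule plus[of "\<lambda>i. v0 i + v1 i"])
    show "(\<Sum>r\<in>R. v0 (i + r) + v1 (i + r)) + (\<Sum>f\<in>F. v0 (i + f) + v1 (i + f)) = 0" for i
      using spec[OF eq1, of i] eq2'[of i] unfolding sum.distrib by linarith
  qed (use per in simp)
  moreover have "\<forall>i. v0 i - v1 i = v0 0 - v1 0"
  proof (rule minus[of "\<lambda>i. v0 i - v1 i"])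
    show "(\<Sum>r\<in>R. v0 (i + r) - v1 (i + r)) = (\<Sum>f\<in>F. v0 (i + f) - v1 (i + f))" for i
      using spec[OF eq1, of i] eq2'[of i] unfolding sum_subtractf by linarith
  qed (use per in simp)
  ultimately have "v0 i = v0 0 \<and> v1 i = - v0 0" for i
    by (smt (verit))
  then show "\<exists>c. \<forall>i. v0 i = c \<and> v1 i = - c" by blast
qed


text \<open>With x the shift by 1, and up to sign and a power of x, the two pairs differ by (1 -
  x)(1 - x^2), while their sum is (1 + x)(1 + x^2) modulo 2. In both cases the differences of
  neighbours have period 2, and also the odd period \<open>m\<close>, so they are constant.\<close>

lemma alternating_kernel_odd:
  fixes e :: int
  assumes "e > 0" and m: "m = 2 * e + 3" and fin: "finite Y"
    and sym: "\<And>r. r \<in> Y \<Longrightarrow> - r \<in> Y"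
    and disj: "Y \<inter> {e, - e, e + 1, - (e + 1)} = {}"
  shows "alternating_kernel m (Y \<union> {e + 1, - (e + 1)}) (Y \<union> {e, - e})"
    (is "alternating_kernel m ?R ?F")
proof (rule alternating_kernel_symmetric)
  have "m > 0" using \<open>e > 0\<close> m by simp
  have cop: "coprime 2 m" using m by (auto simp: coprime_left_2_iff_odd)
  \<comment> \<open>Evaluating at \<open>i + e + 3\<close> moves the pairs to the residues {1, 2}
    and {0, 3} modulo \<open>m\<close>.\<close>
  have sums: "(\<Sum>r\<in>?R. v (i + e + 3 + r)) = (\<Sum>r\<in>Y. v (i + e + 3 + r)) + (v (i + 1) + v (i + 2))"
    "(\<Sum>r\<in>?F. v (i + e + 3 + r)) = (\<Sum>r\<in>Y. v (i + e + 3 + r)) + (v i + v (i + 3))"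
    if per: "\<And>j. v (j + m) = v j" for v :: "int \<Rightarrow> 'c :: comm_monoid_add" and i
  proof -
    have "v (i + e + 3 + (e + 1)) = v (i + 1)" "v (i + e + 3 + e) = v i"
      by (rule periodic_cong[of v m, OF per], simp add: m)+
    moreover have "i + e + 3 + - (e + 1) = i + 2" "i + e + 3 + - e = i + 3" by auto
    moreover have "e + 1 \<noteq> - (e + 1)" "e \<noteq> - e" using \<open>e > 0\<close> by auto
    ultimately show
      "(\<Sum>r\<in>?R. v (i + e + 3 + r)) = (\<Sum>r\<in>Y. v (i + e + 3 + r)) + (v (i + 1) + v (i + 2))"
      "(\<Sum>r\<in>?F. v (i + e + 3 + r)) = (\<Sum>r\<in>Y. v (i + e + 3 + r)) + (v i + v (i + 3))"
      using fin disj by (subst sum.union_disjoint; simp)+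
  qed
  show "\<forall>i. w i = w 0" if per: "\<And>j. w (j + m) = w j"
    and ker: "\<And>i. (\<Sum>r\<in>?R. w (i + r)) = (\<Sum>f\<in>?F. w (i + f))" for w :: "int \<Rightarrow> real"
  proof -
    have *: "w (i + 1) + w (i + 2) = w i + w (i + 3)" for i
      using ker[of "i + e + 3"] unfolding sums[of w, OF per] by simp
    define \<delta> where "\<delta> i = w (i + 1) - w i" for i
    have "\<delta> (i + 2) = \<delta> i" for i using *[of i] by (simp add: \<delta>_def algebra_simps)
    moreover have "\<delta> (i + m) = \<delta> i" for i
      using per[of i] per[of "i + 1"] by (simp add: \<delta>_def algebra_simps)
    ultimately have "\<delta> i = \<delta> 0" for i using periodic_coprime_const[of \<delta> 2 m] cop by blast
    then have "w i = w 0" for i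
      using periodic_arith_const[of w m "\<delta> 0", OF per \<open>m > 0\<close>] by (simp add: \<delta>_def)
    then show ?thesis by blast
  qed
  show "\<forall>i. z i = 0" if per: "\<And>j. z (j + m) = z j"
    and ker: "\<And>i. (\<Sum>r\<in>?R. z (i + r)) + (\<Sum>f\<in>?F. z (i + f)) = 0" for z :: "int \<Rightarrow> real"
  proof (rule ccontr)
    assume "\<not> (\<forall>i. z i = 0)"
    then obtain a where "z a \<noteq> 0" by blast
    have "finite ?R" "finite ?F" using fin by auto
    from integer_kernel_vector2[of z m ?R ?F a, OF per \<open>m > 0\<close> this ker \<open>z a \<noteq> 0\<close>]
    obtain u :: "int \<Rightarrow> int" and b where u: "\<And>i. u (i + m) = u i"
      and ku: "\<And>i. (\<Sum>r\<in>?R. u (i + r)) + (\<Sum>f\<in>?F. u (i + f)) = 0" and ub: "odd (u b)"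
      by blast
    \<comment> \<open>The shifts in \<open>Y\<close> occur in both sets and contribute an even
      number.\<close>
    have *: "even (u (i + 1) + u (i + 2) + u i + u (i + 3))" for i
      using ku[of "i + e + 3"] unfolding sums[of u, OF u] by presburger
    define \<delta> where "\<delta> i = even (u (i + 1) + u i)" for i
    have "\<delta> (i + 2) = \<delta> i" for i using *[of i] by (simp add: \<delta>_def algebra_simps) blast
    moreover have "\<delta> (i + m) = \<delta> i" for i
      using u[of i] u[of "i + 1"] by (simp add: \<delta>_def algebra_simps)
    ultimately have \<delta>: "\<delta> i = \<delta> 0" for i using periodic_coprime_const[of \<delta> 2 m] cop by blast
    have odd_card: "odd (card {0..<m})" using m \<open>m > 0\<close> by (simp add: even_nat_iff)
    \<comment> \<open>Otherwise the parity of \<open>u\<close> would alternate, which is impossible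
      around a cycle of odd length.\<close>
    have "\<delta> 0"
    proof (rule ccontr)
      assume "\<not> \<delta> 0"
      then have "odd (u (i + 1) + u i)" for i using \<delta>[of i] by (simp add: \<delta>_def)
      then have "odd (\<Sum>i\<in>{0..<m}. u (i + 1) + u i)"
        using odd_sum_iff_odd_card[of "{0..<m}" "\<lambda>i. u (i + 1) + u i"] odd_card by simp
      moreover have "(\<Sum>i\<in>{0..<m}. u (i + 1) + u i) = 2 * (\<Sum>i\<in>{0..<m}. u i)"
        using sum_period_shift[of u m 1, OF u \<open>m > 0\<close>] by (simp add: sum.distrib)
      ultimately show False by simp
    qed
    then have "even (u (i + 1)) = even (u i)" for i using \<delta>[of i] by (auto simp: \<delta>_def)
    from periodic_cong[of "\<lambda>i. even (u i)" 1, OF this] ub have odd: "odd (u i)" for i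
      by (metis one_dvd)
    \<comment> \<open>An odd number of odd terms has a nonzero sum, but adding up all kernel
      equations shows that a positive multiple of this sum is 0.\<close>
    have "odd (\<Sum>i\<in>{0..<m}. u i)"
      using odd_sum_iff_odd_card[of "{0..<m}" u] odd odd_card by simp
    moreover have "int (card ?R + card ?F) * (\<Sum>i\<in>{0..<m}. u i) = 0"
    proof -
      have *: "(\<Sum>i\<in>{0..<m}. \<Sum>r\<in>S. u (i + r)) = int (card S) * (\<Sum>i\<in>{0..<m}. u i)" for S
        by (subst sum.swap) (simp add: sum_period_shift[of u m, OF u \<open>m > 0\<close>])
      have "0 = (\<Sum>i\<in>{0..<m}. (\<Sum>r\<in>?R. u (i + r)) + (\<Sum>f\<in>?F. u (i + f)))"
        by (simp only: ku sum.neutral_const)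
      also have "\<dots> = int (card ?R + card ?F) * (\<Sum>i\<in>{0..<m}. u i)"
        by (simp only: sum.distrib * of_nat_add distrib_right)
      finally show ?thesis by simp
    qed
    moreover have "card ?R > 0" using fin by (subst card_gt_0_iff) auto
    ultimately show False by (metis add_gr_0 even_zero mult_eq_0_iff of_nat_0_eq_iff less_irrefl)
  qed
qed (rule sum_symmetric; use sym in auto)+

text \<open>Since \<open>h\<close> is odd, \<open>m\<close> is 2 modulo 4, so the periods 4 and
  \<open>m\<close> together give period 2; this is used for real differences and again for parities.
  Parities then depend only on the class of the index modulo 2, and a sum over one such class gives
  the contradiction.\<close>

lemma alternating_kernel_twice_odd:
  fixes h :: int
  assumes "h > 1" "odd h" and m: "m = 2 * h" and fin: "finite Y" and even_card: "even (card Y)"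
    and sym: "\<And>r. r \<in> Y \<Longrightarrow> - r \<in> Y"
    and disj: "Y \<inter> {0, h, 1, - 1} = {}"
  shows "alternating_kernel m (Y \<union> {1, - 1}) (Y \<union> {0, h})"
    (is "alternating_kernel m ?R ?F")
proof (rule alternating_kernel_symmetric)
  have "m > 0" using \<open>h > 1\<close> m by simp
  have sums: "(\<Sum>r\<in>?R. v (i + r)) = (\<Sum>r\<in>Y. v (i + r)) + (v (i + 1) + v (i - 1))"
    "(\<Sum>r\<in>?F. v (i + r)) = (\<Sum>r\<in>Y. v (i + r)) + (v i + v (i + h))"
    for v :: "int \<Rightarrow> 'c :: comm_monoid_add" and i
    using fin disj \<open>h > 1\<close> by (subst sum.union_disjoint; simp)+
  show "(\<Sum>r\<in>?R. v (i - r)) = (\<Sum>r\<in>?R. v (i + r))" for v :: "int \<Rightarrow> real" and i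
    by (rule sum_symmetric) (use sym in auto)
  have h2: "v (i + h + h) = v i" "v (i - h) = v (i + h)" if per: "\<And>j. v (j + m) = v j"
    for v :: "int \<Rightarrow> 'c" and i
    by (rule periodic_cong[of v m, OF per], simp add: m)+
  \<comment> \<open>\<open>?F\<close> is symmetric only modulo \<open>m\<close>: \<open>h\<close>
    and \<open>- h\<close> differ by \<open>m\<close>.\<close>
  show "(\<Sum>r\<in>?F. v (i - r)) = (\<Sum>r\<in>?F. v (i + r))" if per: "\<And>j. v (j + m) = v j"
    for v :: "int \<Rightarrow> real" and i
  proof -
    have "(\<Sum>r\<in>?F. v (i - r)) = (\<Sum>r\<in>Y. v (i - r)) + (v i + v (i - h))"
      using sums(2)[of "\<lambda>x. v (2 * i - x)" i] h2(2)[of v, OF per] 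
      using fin disj \<open>h > 1\<close> by (subst sum.union_disjoint; simp)
    then show ?thesis
      using sum_symmetric[of Y v i] sym h2(2)[of v i, OF per] sums(2)[of v i] by simp
  qed
  show "\<forall>i. w i = w 0" if per: "\<And>j. w (j + m) = w j"
    and ker: "\<And>i. (\<Sum>r\<in>?R. w (i + r)) = (\<Sum>f\<in>?F. w (i + f))" for w :: "int \<Rightarrow> real"
  proof -
    have *: "w (i + 1) + w (i - 1) = w i + w (i + h)" for i
      using ker[of i] unfolding sums by simp
    \<comment> \<open>\<open>x\<close> is the part of \<open>w\<close> that changes sign under the
      shift by \<open>h\<close>; for it the right-hand side of the relation cancels.\<close>
    have anti: "w (i + h) = w i" for i
    proof -
      define x where "x i = w i - w (i + h)" for i
      have "x (i + 1) + x (i - 1) = 0" for i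
        using *[of i] *[of "i + h"] h2(1)[of w i, OF per] by (simp add: x_def algebra_simps)
      from this[of "_ + 1"] have x2: "x (i + 2) = - x i" for i by (simp add: algebra_simps eq_neg_iff_add_eq_0)
      have x4: "x (i + 4) = x i" for i using x2[of "i + 2"] x2[of i] by (simp add: algebra_simps)
      have xm: "x (i + m) = x i" for i
        using per[of i] per[of "i + h"] by (simp add: x_def algebra_simps)
      obtain t where t: "h = 2 * t + 1" using \<open>odd h\<close> by (rule oddE)
      \<comment> \<open>Here \<open>m = 4 * t + 2\<close>, so \<open>x\<close> is both fixed and
        negated by the shift by 2.\<close>
      have "x (i + 2) = x ((i + m) + (- t) * 4)" for i by (simp add: m t)
      also have "\<dots> i = x i" for i using periodic_add_mult[of x 4, OF x4] xm by metis
      finally have "x i = 0" for i using x2[of i] by simp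
      then show ?thesis by (simp add: x_def)
    qed
    \<comment> \<open>As \<open>w\<close> has period \<open>h\<close>, the relation now says that
      its second differences vanish.\<close>
    define \<delta> where "\<delta> i = w (i + 1) - w i" for i
    have "\<delta> (i + 1) = \<delta> i" for i
      using *[of "i + 1"] anti[of "i + 1"] by (simp add: \<delta>_def algebra_simps)
    from periodic_cong[of \<delta> 1, OF this] have "\<delta> i = \<delta> 0" for i by simp
    then have "w i = w 0" for i
      using periodic_arith_const[of w m "\<delta> 0", OF per \<open>m > 0\<close>] by (simp add: \<delta>_def)
    then show ?thesis by blast
  qed
  show "\<forall>i. z i = 0" if per: "\<And>j. z (j + m) = z j"
    and ker: "\<And>i. (\<Sum>r\<in>?R. z (i + r)) + (\<Sum>f\<in>?F. z (i + f)) = 0" for z :: "int \<Rightarrow> real"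
  proof (rule ccontr)
    assume "\<not> (\<forall>i. z i = 0)"
    then obtain a where "z a \<noteq> 0" by blast
    have "finite ?R" "finite ?F" using fin by auto
    from integer_kernel_vector2[of z m ?R ?F a, OF per \<open>m > 0\<close> this ker \<open>z a \<noteq> 0\<close>]
    obtain u :: "int \<Rightarrow> int" and b where u: "\<And>i. u (i + m) = u i"
      and ku: "\<And>i. (\<Sum>r\<in>?R. u (i + r)) + (\<Sum>f\<in>?F. u (i + f)) = 0" and ub: "odd (u b)"
      by blast
    have *: "even (u (i + 1) + u (i - 1) + u i + u (i + h))" for i
      using ku[of i] unfolding sums by presburger
    \<comment> \<open>Modulo 2 the square of x + 1/x + 1 + x^h is x^2 + 1/x^2, because x^(2h) = 1;
      the four instances carry out this squaring.\<close>
    have u4: "even (u (i + 4)) = even (u i)" for i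
      using *[of "i + 2"] *[of "i + 3"] *[of "i + 1"] *[of "i + 2 + h"] h2(1)[of u "i + 2", OF u]
      by (simp add: algebra_simps) blast
    obtain t where t: "h = 2 * t + 1" using \<open>odd h\<close> by (rule oddE)
    have "even (u (i + 2)) = even (u ((i + m) + (- t) * 4))" for i by (simp add: m t)
    also have "\<dots> i = even (u i)" for i
      using periodic_add_mult[of "\<lambda>i. even (u i)" 4, OF u4] u by metis
    finally have u2: "even (u i) = even (u j)" if "even (i - j)" for i j
      using periodic_cong[of "\<lambda>i. even (u i)" 2] that by blast
    \<comment> \<open>The sign character modulo 2 separates even from odd indices; kernel equations
      weighted by it multiply the alternating sum of \<open>u\<close> by the character sum of the
      shifts.\<close>
    define \<epsilon> :: "int \<Rightarrow> int" where "\<epsilon> i = (if even i then 1 else - 1)" for i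
    have \<epsilon>: "\<epsilon> (i + j) = \<epsilon> i * \<epsilon> j" "\<epsilon> i * \<epsilon> i = 1" for i j by (auto simp: \<epsilon>_def)
    have pe: "\<epsilon> (i + m) * u (i + m) = \<epsilon> i * u i" for i using u[of i] by (simp add: \<epsilon>_def m)
    let ?U = "\<Sum>i\<in>{0..<m}. u i" and ?A = "\<Sum>i\<in>{0..<m}. \<epsilon> i * u i"
    have total: "(\<Sum>i\<in>{0..<m}. \<Sum>r\<in>S. u (i + r)) = int (card S) * ?U" for S
      by (subst sum.swap) (simp add: sum_period_shift[of u m, OF u \<open>m > 0\<close>])
    have alternating: "(\<Sum>i\<in>{0..<m}. \<epsilon> i * (\<Sum>r\<in>S. u (i + r))) = (\<Sum>r\<in>S. \<epsilon> r) * ?A" for S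
    proof -
      have "\<epsilon> i * (\<Sum>r\<in>S. u (i + r)) = (\<Sum>r\<in>S. \<epsilon> r * (\<epsilon> (i + r) * u (i + r)))" for i
        by (simp add: sum_distrib_left \<epsilon>(1) mult.assoc[symmetric] mult.commute[of "\<epsilon> _" "\<epsilon> i"])
           (simp add: mult.assoc \<epsilon>(2))
      then have "(\<Sum>i\<in>{0..<m}. \<epsilon> i * (\<Sum>r\<in>S. u (i + r)))
        = (\<Sum>r\<in>S. \<Sum>i\<in>{0..<m}. \<epsilon> r * (\<epsilon> (i + r) * u (i + r)))"
        by (subst sum.swap) simp
      also have "\<dots> = (\<Sum>r\<in>S. \<epsilon> r * ?A)"
        using sum_period_shift[of "\<lambda>i. \<epsilon> i * u i" m, OF pe \<open>m > 0\<close>]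
        by (simp add: sum_distrib_left[symmetric])
      finally show ?thesis by (simp add: sum_distrib_right)
    qed
    have "?U = 0"
    proof -
      have "0 = (\<Sum>i\<in>{0..<m}. (\<Sum>r\<in>?R. u (i + r)) + (\<Sum>f\<in>?F. u (i + f)))"
        by (simp only: ku sum.neutral_const)
      also have "\<dots> = int (card ?R + card ?F) * ?U"
        by (simp only: sum.distrib total of_nat_add distrib_right)
      finally have "int (card ?R + card ?F) * ?U = 0" by simp
      moreover have "card ?R > 0" using fin by (subst card_gt_0_iff) auto
      ultimately show ?thesis by (metis add_gr_0 mult_eq_0_iff of_nat_0_eq_iff less_irrefl)
    qed
    moreover have "?A = 0"
    proof -
      have "0 = (\<Sum>i\<in>{0..<m}. \<epsilon> i * ((\<Sum>r\<in>?R. u (i + r)) + (\<Sum>f\<in>?F. u (i + f))))"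
        by (simp only: ku sum.neutral_const mult_zero_right)
      also have "\<dots> = ((\<Sum>r\<in>?R. \<epsilon> r) + (\<Sum>f\<in>?F. \<epsilon> f)) * ?A"
        by (simp only: distrib_left sum.distrib alternating distrib_right)
      \<comment> \<open>The pair \<open>1, - 1\<close> contributes -2, the pair \<open>0, h\<close>
        contributes 0. With \<open>card Y\<close> even the factor is 2 modulo 4, hence
        nonzero.\<close>
      also have "(\<Sum>r\<in>?R. \<epsilon> r) + (\<Sum>f\<in>?F. \<epsilon> f) = 2 * (\<Sum>r\<in>Y. \<epsilon> r) - 2"
        using sums[of \<epsilon> 0] \<open>odd h\<close> by (simp add: \<epsilon>_def)
      finally have "(2 * (\<Sum>r\<in>Y. \<epsilon> r) - 2) * ?A = 0" by simp
      moreover have "even (\<Sum>r\<in>Y. \<epsilon> r)"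
        using odd_sum_iff_odd_card[of Y \<epsilon>] fin even_card by (simp add: \<epsilon>_def)
      ultimately show ?thesis by auto
    qed
    \<comment> \<open>The weight \<open>1 + \<epsilon> b * \<epsilon> i\<close> is 2 on the class of
      \<open>b\<close> and 0 on the other class.\<close>
    ultimately have "(\<Sum>i\<in>{0..<m}. u i + \<epsilon> b * (\<epsilon> i * u i)) = 0"
      by (simp add: sum.distrib sum_distrib_left[symmetric])
    also have "(\<Sum>i\<in>{0..<m}. u i + \<epsilon> b * (\<epsilon> i * u i))
      = (\<Sum>i\<in>{0..<m}. if even (i - b) then 2 * u i else 0)"
      by (rule sum.cong) (auto simp: \<epsilon>_def)
    also have "\<dots> = 2 * (\<Sum>i\<in>{i\<in>{0..<m}. even (i - b)}. u i)"
      by (simp add: sum.inter_filter[symmetric] sum_distrib_left)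
    finally have "(\<Sum>i\<in>{i\<in>{0..<m}. even (i - b)}. u i) = 0" by simp
    \<comment> \<open>The class of \<open>b\<close> has \<open>h\<close> members, so this is an odd
      number of odd summands.\<close>
    moreover have "odd (\<Sum>i\<in>{i\<in>{0..<m}. even (i - b)}. u i)"
    proof -
      have "bij_betw (\<lambda>j. 2 * j + b mod 2) {0..<h} {i\<in>{0..<m}. even (i - b)}"
        by (rule bij_betwI[where g = "\<lambda>i. i div 2"]) (auto simp: m, presburger+)
      then have "card {i\<in>{0..<m}. even (i - b)} = nat h"
        using bij_betw_same_card by fastforce
      then have "odd (card {i\<in>{0..<m}. even (i - b)})"
        using \<open>odd h\<close> \<open>h > 1\<close> by (simp add: even_nat_iff)
      moreover have "odd (u i)" if "even (i - b)" for i using u2[OF that] ub by simp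
      moreover have "finite {i\<in>{0..<m}. even (i - b)}" by (rule finite_subset[of _ "{0..<m}"]) auto
      ultimately show ?thesis
        using odd_sum_iff_odd_card[of "{i\<in>{0..<m}. even (i - b)}" u] by blast
    qed
    ultimately show False by simp
  qed
qed

section \<open>Period divisible by four\<close>

text \<open>Let U be the sum over \<open>insert 0 ?R\<close>, \<open>z = v0 + v1\<close> and
  \<open>d i = v0 i + v1 (i + 1)\<close>. The equations become U z = d and U z = d shifted by one,
  so \<open>d\<close> is constant. Injectivity of U makes \<open>z\<close> constant, and then
  \<open>v0\<close> has constant increments.\<close>

lemma alternating_kernel_lifted:
  fixes h :: int
  assumes "h > 0" and m: "m = 2 * h" and fin: "finite P" and one: "1 \<in> P" and zero: "0 \<notin> P"
    and sym: "\<And>(g :: int \<Rightarrow> real) i. (\<And>j. g (j + h) = g j) \<Longrightarrow> (\<Sum>s\<in>P. g (i - s)) = (\<Sum>s\<in>P. g (i + s))"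
    and disj: "P \<inter> (\<lambda>s. s + h) ` P = {}" and zero': "- h \<notin> P"
  shows "alternating_kernel m (P \<union> (\<lambda>s. s + h) ` P) (insert 0 (P \<union> (\<lambda>s. s + h) ` P) - {1})"
    (is "alternating_kernel m ?R ?F")
  unfolding alternating_kernel_def
proof (intro allI impI)
  have "m > 0" using \<open>h > 0\<close> m by simp
  have finR: "finite ?R" "finite ?F" using fin by auto
  have sumR: "(\<Sum>r\<in>?R. v r) = (\<Sum>s\<in>P. v s + v (s + h))" for v :: "int \<Rightarrow> 'c :: comm_monoid_add"
    using disj fin by (subst sum.union_disjoint) (auto simp: sum.reindex sum.distrib)
  have "0 \<notin> ?R" using zero zero' by auto (metis add.commute add_eq_0_iff)
  then have sumF: "(\<Sum>r\<in>?F. v r) = v 0 + (\<Sum>r\<in>?R. v r) - v 1" for v :: "int \<Rightarrow> real"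
    using finR(1) one by (subst sum_diff) auto
  have inj: "\<forall>i. w i = 0" if per: "\<And>j. w (j + m) = w j"
    and ker: "\<And>i. w i + (\<Sum>r\<in>?R. w (i + r)) = 0" for w :: "int \<Rightarrow> real"
  proof (rule ccontr)
    assume "\<not> (\<forall>i. w i = 0)"
    then obtain a where "w a \<noteq> 0" by blast
    \<comment> \<open>The second set \<open>{0}\<close> supplies the identity term of U.\<close>
    have "(\<Sum>r\<in>?R. w (i + r)) + (\<Sum>f\<in>{0}. w (i + f)) = 0" for i using ker[of i] by simp
    from integer_kernel_vector2[of w m ?R "{0}" a, OF per \<open>m > 0\<close> finR(1) finite.insertI[OF finite.emptyI] this \<open>w a \<noteq> 0\<close>]
    obtain u :: "int \<Rightarrow> int" and b where u: "\<And>i. u (i + m) = u i"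
      and ku: "\<And>i. (\<Sum>r\<in>?R. u (i + r)) + (\<Sum>f\<in>{0}. u (i + f)) = 0" and ub: "odd (u b)"
      by blast
    have u_eq: "u i = - (\<Sum>s\<in>P. u (i + s) + u (i + (s + h)))" for i
      using ku[of i] unfolding sumR by simp
    have "u (x + (h + (y + h))) = u (x + y)" for x y
      using u[of "x + y"] by (simp add: m algebra_simps)
    \<comment> \<open>Shifting by \<open>h\<close> only swaps the two copies of \<open>P\<close> in
      \<open>u_eq\<close>. With this period both copies contribute equally, whence the factor
      2.\<close>
    then have "u (i + h) = u i" for i
      using u_eq[of i] u_eq[of "i + h"] by (simp add: sum.distrib algebra_simps)
    then have "u b = - (\<Sum>s\<in>P. 2 * u (b + s))"
      using u_eq[of b] by (simp add: add.assoc[symmetric])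
    also have "even \<dots>" by (simp add: sum_distrib_left[symmetric])
    finally show False using ub by simp
  qed
  fix v0 v1 :: "int \<Rightarrow> real"
  assume per: "\<forall>i. v0 (i + m) = v0 i" "\<forall>i. v1 (i + m) = v1 i"
    and eq1: "\<forall>i. (\<Sum>r\<in>?R. v0 (i + r)) + (\<Sum>f\<in>?F. v1 (i + f)) = 0"
    and eq2: "\<forall>i. (\<Sum>f\<in>?F. v0 (i - f)) + (\<Sum>r\<in>?R. v1 (i - r)) = 0"
  define z where "z i = v0 i + v1 i" for i
  have symR: "(\<Sum>r\<in>?R. v (i - r)) = (\<Sum>r\<in>?R. v (i + r))" if per: "\<forall>j. v (j + m) = v j"
    for v :: "int \<Rightarrow> real" and i
  proof -
    \<comment> \<open>Sums over \<open>?R\<close> see \<open>v\<close> only through its folding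
      \<open>g\<close>, so symmetry of \<open>P\<close> modulo \<open>h\<close> suffices.\<close>
    define g where "g x = v x + v (x + h)" for x
    have gh: "g (x + h) = g x" for x using per[rule_format, of x] by (simp add: g_def m algebra_simps)
    have "v (i - s) + v (i - (s + h)) = g (i - s)" for s
      using gh[of "i - s - h"] per[rule_format, of "i - s - h"] by (simp add: g_def m algebra_simps)
    moreover have "v (i + s) + v (i + (s + h)) = g (i + s)" for s
      by (simp add: g_def algebra_simps)
    ultimately show ?thesis unfolding sumR using sym[of g i, OF gh] by simp
  qed
  define d where "d i = v0 i + v1 (i + 1)" for i
  have zd: "z i + (\<Sum>r\<in>?R. z (i + r)) = d i" for i
    using eq1[rule_format, of i] unfolding sumF z_def d_def sum.distrib by simp
  have "z i + (\<Sum>r\<in>?R. z (i + r)) = d (i - 1)" for i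
    using eq2[rule_format, of i] unfolding sumF symR[OF per(1)] symR[OF per(2)]
    unfolding z_def d_def sum.distrib by simp
  then have "d (i + 1) = d i" for i using zd[of "i + 1"] by simp
  from periodic_cong[of d 1, OF this] have d: "d i = d 0" for i by simp
  \<comment> \<open>U multiplies constants by \<open>card ?R + 1\<close>, so \<open>c\<close> is the
    constant that it maps to \<open>d 0\<close>.\<close>
  define c where "c = d 0 / (real (card ?R) + 1)"
  have "real (card ?R) + 1 \<noteq> 0" by linarith
  then have "(real (card ?R) + 1) * c = d 0" by (simp add: c_def)
  then have c: "c + real (card ?R) * c = d 0" by (simp only: distrib_right mult_1_left add.commute)
  have "\<forall>i. z i - c = 0"
  proof (rule inj)
    show "z (j + m) - c = z j - c" for j using per by (simp add: z_def)
    show "z i - c + (\<Sum>r\<in>?R. z (i + r) - c) = 0" for i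
      using zd[of i] d[of i] c unfolding sum_subtractf sum_constant by linarith
  qed
  then have z: "z i = c" for i by simp
  have "v0 (i + 1) - v0 i = z 0 - d 0" for i
    using d[of i] z[of "i + 1"] z[of 0] by (simp add: d_def z_def)
  from periodic_arith_const[of v0 m, OF _ \<open>m > 0\<close> this] have v0: "v0 i = v0 0" for i
    using per(1) by blast
  have v1: "v1 i = v1 0" for i using z[of i] z[of 0] v0[of i] by (simp add: z_def)
  have "(\<Sum>r\<in>?R. v0 (0 + r)) + (\<Sum>f\<in>?F. v1 (0 + f)) = 0" using eq1 by blast
  then have "card ?R * (v0 0 + v1 0) = 0"
    unfolding sumF v0[of "_ + _"] v1[of "_ + _"] by (simp add: algebra_simps)
  moreover have "card ?R \<noteq> 0" using finR one by (subst card_0_eq) auto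
  ultimately have "v0 0 + v1 0 = 0" by simp
  then show "\<exists>c. \<forall>i. v0 i = c \<and> v1 i = - c" using v0 v1 by (metis add_eq_0_iff)
qed

text \<open>Here R^2 = 2 + 2 x^(2h) and F F' = 2 + x + 1/x, so elimination leaves x + 1/x = 2 x^(2h)
  on each half.\<close>

lemma alternating_kernel_quarter:
  fixes h :: int
  assumes "h > 0" and m: "m = 4 * h"
  shows "alternating_kernel m {h, 3 * h} {0, 1}"
  unfolding alternating_kernel_def
proof (intro allI impI)
  have "m > 0" using \<open>h > 0\<close> m by simp
  fix v0 v1 :: "int \<Rightarrow> real"
  assume per: "\<forall>i. v0 (i + m) = v0 i" "\<forall>i. v1 (i + m) = v1 i"
    and "\<forall>i. (\<Sum>r\<in>{h, 3 * h}. v0 (i + r)) + (\<Sum>f\<in>{0, 1}. v1 (i + f)) = 0"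
    and "\<forall>i. (\<Sum>f\<in>{0, 1}. v0 (i - f)) + (\<Sum>r\<in>{h, 3 * h}. v1 (i - r)) = 0"
  then have eq1: "v0 (i + h) + v0 (i + 3 * h) + v1 i + v1 (i + 1) = 0"
    and eq2: "v0 i + v0 (i - 1) + v1 (i - h) + v1 (i - 3 * h) = 0" for i
    using \<open>h > 0\<close> by (auto simp: algebra_simps)
  have const: "v i = v j" if per: "\<And>i. v (i + m) = v i"
    and eq: "\<And>i. v (i + 1) + v (i - 1) = 2 * v (i + 2 * h)" for v :: "int \<Rightarrow> real" and i j
  proof -
    \<comment> \<open>Along steps of \<open>2 * h + 1\<close> the factor x^(2h) is absorbed and the
      relation becomes a vanishing second difference.\<close>
    define x where "x j = v (j * (2 * h + 1))" for j
    have "x (j + 1) + x (j - 1) = 2 * x j" for j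
    proof -
      have "v (j * (2 * h + 1) + 2 * h + 1) + v (j * (2 * h + 1) + 2 * h - 1) = 2 * v (j * (2 * h + 1) + 2 * h + 2 * h)"
        by (rule eq)
      moreover have "v (j * (2 * h + 1) + 2 * h + 2 * h) = v (j * (2 * h + 1))"
        "v (j * (2 * h + 1) + 2 * h - 1) = v ((j - 1) * (2 * h + 1))"
        by (rule periodic_cong[of v m, OF per], simp add: m algebra_simps)+
      ultimately show ?thesis by (simp add: x_def algebra_simps)
    qed
    from this[of "_ + 1"] have "x (i + 1 + 1) - x (i + 1) = x (i + 1) - x i" for i
      by (simp add: algebra_simps)
    from periodic_cong[of "\<lambda>i. x (i + 1) - x i" 1, OF this] have step: "x (i + 1) - x i = x 1 - x 0" for i
      by (metis add_0 one_dvd)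
    have "x (i + m) = x i" for i unfolding x_def
      by (rule periodic_cong[of v m, OF per]) (simp add: algebra_simps)
    from periodic_arith_const[of x m, OF this \<open>m > 0\<close> step] have x: "x i = x 0" for i .
    have "v i = x (i * (2 * h + 1))" for i unfolding x_def
    proof (rule periodic_cong[of v m, OF per])
      \<comment> \<open>\<open>2 * h + 1\<close> is its own inverse modulo \<open>4 * h\<close>, so
        its multiples reach every index.\<close>
      have "i - i * (2 * h + 1) * (2 * h + 1) = m * (- i * (h + 1))" by (simp add: m algebra_simps)
      then show "m dvd i - i * (2 * h + 1) * (2 * h + 1)" by simp
    qed
    then show ?thesis using x by metis
  qed
  have fold: "v (i - 3 * h) = v (i + h)" "v (i - h) = v (i + 3 * h)" "v (i + 4 * h) = v i" 
    "v (i + h + 3 * h) = v i"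
    "v (i + 3 * h - h) = v (i + 2 * h)" "v (i + 3 * h - 3 * h) = v i" "v (i + h - 3 * h) = v (i + 2 * h)"
    "v (i + h - h) = v i" "v (i + 3 * h + 3 * h) = v (i + 2 * h)" "v (i + h + h) = v (i + 2 * h)"
    "v (i + 3 * h + h) = v i" 
    if "\<forall>i. v (i + m) = v i" for v :: "int \<Rightarrow> real" and i
    by (rule periodic_cong[of v m], use that in \<open>simp_all add: m\<close>)+
  \<comment> \<open>Applying R to the second equation and F' to the first produces the same terms in
    \<open>v0\<close>, which cancel.\<close>
  have "v1 (i + 1) + v1 (i - 1) = 2 * v1 (i + 2 * h)" for i
    using eq2[of "i + h"] eq2[of "i + 3 * h"] eq1[of i] eq1[of "i - 1"]
    using fold[OF per(1)] fold[OF per(2)] by (simp add: algebra_simps)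
  then have v1: "v1 i = v1 0" for i using const[of v1] per(2) by blast
  define b where "b = v1 0"
  have v1b: "v1 i = b" for i using v1 by (simp add: b_def)
  have "v0 (i + 1) + v0 (i - 1) = 2 * v0 (i + 2 * h)" for i
    using eq1[of "i + h"] eq1[of "i + 3 * h"] eq2[of i] eq2[of "i + 1"]
    unfolding v1b using fold[OF per(1)] by (simp add: algebra_simps)
  then have v0: "v0 i = v0 0" for i using const[of v0] per(1) by blast
  have "v0 0 + v0 0 + v1 0 + v1 0 = 0" using eq1[of 0] v0 v1 by metis
  then have "v1 0 = - v0 0" by simp
  then show "\<exists>c. \<forall>i. v0 i = c \<and> v1 i = - c" using v0 v1 by metis
qed

section \<open>Cayley graphs and dihedral groups\<close>

text \<open>Yields both the degree and, by reindexing, the rows of the adjacency matrix as sums over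
  \<open>S\<close>.\<close>

lemma (in group) cayley_neighbours:
  assumes "S \<subseteq> carrier G" "x \<in> carrier G"
  shows "{y \<in> carrier G. inv x \<otimes> y \<in> S} = (\<lambda>s. x \<otimes> s) ` S" "inj_on (\<lambda>s. x \<otimes> s) S"
proof -
  show "{y \<in> carrier G. inv x \<otimes> y \<in> S} = (\<lambda>s. x \<otimes> s) ` S"
  proof (intro equalityI subsetI)
    fix y assume y: "y \<in> {y \<in> carrier G. inv x \<otimes> y \<in> S}"
    then have "y = x \<otimes> (inv x \<otimes> y)" using assms by (simp add: m_assoc[symmetric])
    then show "y \<in> (\<lambda>s. x \<otimes> s) ` S" using y by blast
  qed (use assms in \<open>auto simp: m_assoc[symmetric]\<close>)
  show "inj_on (\<lambda>s. x \<otimes> s) S" by (rule inj_onI) (use assms in \<open>simp add: subset_iff\<close>)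
qed

lemma (in group) pair_graph_cayley_graph:
  assumes fin: "finite (carrier G)" and S: "S \<subseteq> carrier G" "\<one> \<notin> S" "\<And>s. s \<in> S \<Longrightarrow> inv s \<in> S"
  shows "pair_graph (cayley_graph G S)"
proof
  let ?C = "cayley_graph G S"
  show "finite (pverts ?C)" using fin by (simp add: cayley_graph_def)
  show "finite (parcs ?C)"
    by (rule finite_subset[of _ "carrier G \<times> carrier G"]) (use fin in \<open>auto simp: cayley_graph_def\<close>)
  show "symmetric (with_proj ?C)"
    unfolding symmetric_def with_proj_simps
  proof (rule symI)
    fix x y assume xy: "(x, y) \<in> parcs ?C"
    then have "inv (inv x \<otimes> y) \<in> S" using S(3) by (auto simp: cayley_graph_def)
    then show "(y, x) \<in> parcs ?C" using xy by (auto simp: cayley_graph_def inv_mult_group)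
  qed
qed (use S(2) in \<open>auto simp: cayley_graph_def\<close>)

lemma (in group) regular_graph_cayley_graph:
  assumes fin: "finite (carrier G)" and S: "S \<subseteq> carrier G" "\<one> \<notin> S" "\<And>s. s \<in> S \<Longrightarrow> inv s \<in> S"
  shows "regular_graph (card S) (cayley_graph G S)"
  unfolding regular_graph_def
proof (intro conjI ballI)
  show "pair_graph (cayley_graph G S)" using pair_graph_cayley_graph[OF assms] .
  fix v assume "v \<in> pverts (cayley_graph G S)"
  then have v: "v \<in> carrier G" by (simp add: cayley_graph_def)
  have "out_arcs (with_proj (cayley_graph G S)) v = Pair v ` {y \<in> carrier G. inv v \<otimes> y \<in> S}"
    using v by (auto simp: out_arcs_def cayley_graph_def with_proj_def)
  then show "out_degree (with_proj (cayley_graph G S)) v = card S"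
    using cayley_neighbours[OF S(1) v] by (simp add: out_degree_def card_image inj_on_def)
qed

text \<open>Removes matrices from the later argument: once the null space is the set of multiples of
  \<open>x\<close>, its dimension, its full generator and its span all follow.\<close>

lemma nut_graphI:
  fixes x :: "nat \<Rightarrow> real"
  assumes "pair_graph G" and V: "pverts G = {..<N}" and "N \<ge> 2" and nz: "\<And>i. i < N \<Longrightarrow> x i \<noteq> 0"
    and ker: "\<And>v :: nat \<Rightarrow> real. (\<forall>i<N. (\<Sum>j\<in>{j. j < N \<and> (i, j) \<in> parcs G}. v j) = 0) \<longleftrightarrow>
      (\<exists>c. \<forall>i<N. v i = c * x i)"
  shows "nut_graph G"
proof -
  define A where "A = adjacency_matrix G [0..<N]"
  define w where "w = vec N x"
  have A: "A \<in> carrier_mat N N" by (simp add: A_def adjacency_matrix_def)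
  interpret K: kernel N N A by unfold_locales (rule A)
  have w: "w \<in> carrier_vec N" by (simp add: w_def)
  have Av: "(A *\<^sub>v v) $ i = (\<Sum>j\<in>{j. j < N \<and> (i, j) \<in> parcs G}. v $ j)"
    if "v \<in> carrier_vec N" "i < N" for v i
  proof -
    have "(A *\<^sub>v v) $ i = (\<Sum>j\<in>{0..<N}. if (i, j) \<in> parcs G then v $ j else 0)"
      using that by (simp add: A_def adjacency_matrix_def scalar_prod_def if_distrib
          [of "\<lambda>y. y * _"] cong: if_cong)
    also have "\<dots> = (\<Sum>j\<in>{j. j < N \<and> (i, j) \<in> parcs G}. v $ j)"
      by (simp add: sum.inter_filter[symmetric])
    finally show ?thesis .
  qed
  have mem: "v \<in> mat_kernel A \<longleftrightarrow> (\<exists>c. v = c \<cdot>\<^sub>v w)" for v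
  proof
    assume "v \<in> mat_kernel A"
    then have v: "v \<in> carrier_vec N" "A *\<^sub>v v = 0\<^sub>v N" using mat_kernelD[OF A] by auto
    then have "\<forall>i<N. (\<Sum>j\<in>{j. j < N \<and> (i, j) \<in> parcs G}. v $ j) = 0" by (simp flip: Av)
    then obtain c where "\<forall>i<N. v $ i = c * x i" using ker[of "\<lambda>i. v $ i"] by blast
    then have "v = c \<cdot>\<^sub>v w" using v(1) by (intro eq_vecI) (auto simp: w_def)
    then show "\<exists>c. v = c \<cdot>\<^sub>v w" ..
  next
    assume "\<exists>c. v = c \<cdot>\<^sub>v w"
    then obtain c where v: "v = c \<cdot>\<^sub>v w" ..
    then have "\<forall>i<N. v $ i = c * x i" by (simp add: w_def)
    then have "\<forall>i<N. (\<Sum>j\<in>{j. j < N \<and> (i, j) \<in> parcs G}. v $ j) = 0"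
      using ker[of "\<lambda>i. v $ i"] by blast
    moreover have vc: "v \<in> carrier_vec N" using v w by simp
    ultimately have "A *\<^sub>v v = 0\<^sub>v N" using Av A by (intro eq_vecI) auto
    then show "v \<in> mat_kernel A" using A vc by (intro mat_kernelI)
  qed
  have w_ker: "w \<in> mat_kernel A" using mem[of w] w by (metis one_smult_vec)
  have span: "K.span {w} = mat_kernel A"
  proof -
    have lc: "K.lincomb a {w} = a w \<cdot>\<^sub>v w" for a
      using w_ker by (subst K.Ker.lincomb_def, subst K.Ker.finsum_insert)
        (auto simp: mat_kernel_smult[OF A])
    have "K.span {w} = {K.lincomb a {w} | a. a \<in> {w} \<rightarrow> UNIV}"
      using w_ker by (intro K.Ker.finite_span) auto
    also have "\<dots> = mat_kernel A"
      by (auto simp: lc mem)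
    finally show ?thesis .
  qed
  have "w \<noteq> 0\<^sub>v N"
  proof
    assume "w = 0\<^sub>v N"
    then have "w $ 0 = 0" using \<open>N \<ge> 2\<close> by simp
    then show False using nz[of 0] \<open>N \<ge> 2\<close> by (simp add: w_def)
  qed
  then have "kernel_dim A = 1" using K.Ker.dim1I[of w] span w_ker by simp
  moreover have "full_vec w" using nz by (simp add: full_vec_def w_def)
  \<comment> \<open>The span above is taken inside the kernel, whereas \<open>nut_graph\<close>
    takes it in the ambient space.\<close>
  moreover have "mat_kernel A = LinearCombinations.module.span class_ring (module_vec TYPE(real) N) {w}"
    using span K.span_same[of "{w}"] w_ker by simp
  ultimately show ?thesis
    unfolding nut_graph_def
    using assms(1) V \<open>N \<ge> 2\<close> w_ker unfolding A_def
    by (intro conjI exI[of _ "[0..<N]"] bexI[of _ w]) auto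
qed

text \<open>Accepts any integer exponent, so that products and inverses reduce to integer arithmetic
  modulo \<open>m\<close>.\<close>

definition dihedral_elem :: "nat \<Rightarrow> int \<Rightarrow> bool \<Rightarrow> nat" where
  "dihedral_elem m a b = nat (a mod int m) + (if b then m else 0)"

text \<open>The dihedral group of order \<open>2m\<close> on \<open>{..<2m}\<close>: for \<open>a < m\<close>, the number
  \<open>a\<close> stands for \<open>r\<^sup>a\<close> and \<open>m + a\<close> for \<open>r\<^sup>a s\<close>, where \<open>s r s = r\<^sup>-\<^sup>1\<close>.\<close>

definition dihedral :: "nat \<Rightarrow> nat monoid" where
  "dihedral m = \<lparr>carrier = {..<2 * m},
     mult = (\<lambda>x y. dihedral_elem m (if m \<le> x then int x - int y else int x + int y)
       ((m \<le> x) \<noteq> (m \<le> y))),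
     one = 0\<rparr>"

context
  fixes m :: nat
  assumes m_pos: "m > 0"
begin

lemma dihedral_elem_less: "dihedral_elem m a b < 2 * m"
proof -
  have "nat (a mod int m) < m" using m_pos by (simp add: nat_less_iff)
  then show ?thesis by (simp add: dihedral_elem_def)
qed

lemma dihedral_elem_ge_iff: "m \<le> dihedral_elem m a b \<longleftrightarrow> b"
  using m_pos by (auto simp: dihedral_elem_def nat_less_iff not_le)

lemma dihedral_elem_dvd: "int m dvd int (dihedral_elem m a b) - a"
  using m_pos by (auto simp: dihedral_elem_def mod_eq_dvd_iff[symmetric])

lemma dihedral_elem_cong: "int m dvd a - a' \<Longrightarrow> dihedral_elem m a b = dihedral_elem m a' b"
  by (simp add: dihedral_elem_def mod_eq_dvd_iff[symmetric])

lemma dihedral_elem_eq_iff: "dihedral_elem m a b = dihedral_elem m a' b' \<longleftrightarrow> int m dvd a - a' \<and> b = b'"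
proof
  assume eq: "dihedral_elem m a b = dihedral_elem m a' b'"
  then have "b = b'" using dihedral_elem_ge_iff by metis
  moreover have "int m dvd a - a'"
    using dvd_diff[OF dihedral_elem_dvd[of a' b'] dihedral_elem_dvd[of a b]] eq by simp
  ultimately show "int m dvd a - a' \<and> b = b'" by simp
qed (auto intro: dihedral_elem_cong)

text \<open>The offset \<open>m\<close> marking a reflection vanishes modulo \<open>m\<close>, so
  \<open>int x\<close> can serve as exponent in both cases.\<close>

lemma dihedral_elem_self: "x < 2 * m \<Longrightarrow> dihedral_elem m (int x) (m \<le> x) = x"
proof (cases "m \<le> x")
  case True
  assume "x < 2 * m"
  then have "int x mod int m = int (x - m)"
    using True by (simp add: of_nat_diff mod_pos_pos_trivial[of "int x - int m" "int m", simplified])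
  then show ?thesis using True by (simp add: dihedral_elem_def)
qed (simp add: dihedral_elem_def)

lemma dihedral_cases:
  assumes "x \<in> carrier (dihedral m)"
  obtains a b where "x = dihedral_elem m a b"
  using assms that[of "int x" "m \<le> x"] dihedral_elem_self[of x] by (simp add: dihedral_def)

lemma dihedral_carrier: "dihedral_elem m a b \<in> carrier (dihedral m)"
  using dihedral_elem_less by (simp add: dihedral_def)

lemma dihedral_mult:
  "dihedral_elem m a b \<otimes>\<^bsub>dihedral m\<^esub> dihedral_elem m a' b' =
    dihedral_elem m (if b then a - a' else a + a') (b \<noteq> b')"
proof -
  let ?x = "int (dihedral_elem m a b)" and ?y = "int (dihedral_elem m a' b')"
  have "int m dvd (?x + ?y) - (a + a')" "int m dvd (?x - ?y) - (a - a')"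
    using dvd_add[OF dihedral_elem_dvd[of a b] dihedral_elem_dvd[of a' b']]
      dvd_diff[OF dihedral_elem_dvd[of a b] dihedral_elem_dvd[of a' b']]
    by (simp_all add: algebra_simps)
  then show ?thesis
    by (auto simp: dihedral_def dihedral_elem_ge_iff intro: dihedral_elem_cong)
qed

lemma dihedral_one: "\<one>\<^bsub>dihedral m\<^esub> = dihedral_elem m 0 False"
  by (simp add: dihedral_def dihedral_elem_def)

lemma group_dihedral: "group (dihedral m)"
proof (rule groupI)
  fix x y assume "x \<in> carrier (dihedral m)" "y \<in> carrier (dihedral m)"
  then show "x \<otimes>\<^bsub>dihedral m\<^esub> y \<in> carrier (dihedral m)"
    by (elim dihedral_cases) (simp add: dihedral_mult dihedral_carrier)
next
  fix x y z assume "x \<in> carrier (dihedral m)" "y \<in> carrier (dihedral m)" "z \<in> carrier (dihedral m)"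
  then show "x \<otimes>\<^bsub>dihedral m\<^esub> y \<otimes>\<^bsub>dihedral m\<^esub> z = x \<otimes>\<^bsub>dihedral m\<^esub> (y \<otimes>\<^bsub>dihedral m\<^esub> z)"
    by (elim dihedral_cases) (auto simp: dihedral_mult algebra_simps)
next
  fix x assume x: "x \<in> carrier (dihedral m)"
  then show "\<one>\<^bsub>dihedral m\<^esub> \<otimes>\<^bsub>dihedral m\<^esub> x = x"
    by (elim dihedral_cases) (auto simp: dihedral_mult dihedral_one)
  obtain a b where "x = dihedral_elem m a b" using x by (rule dihedral_cases)
  then have "dihedral_elem m (if b then a else - a) b \<otimes>\<^bsub>dihedral m\<^esub> x = \<one>\<^bsub>dihedral m\<^esub>"
    by (simp add: dihedral_mult dihedral_one)
  then show "\<exists>y\<in>carrier (dihedral m). y \<otimes>\<^bsub>dihedral m\<^esub> x = \<one>\<^bsub>dihedral m\<^esub>"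
    using dihedral_carrier by blast
qed (simp add: dihedral_one dihedral_carrier)

lemma dihedral_inv:
  "inv\<^bsub>dihedral m\<^esub> (dihedral_elem m a b) = dihedral_elem m (if b then a else - a) b"
  by (rule group.inv_equality[OF group_dihedral])
    (auto simp: dihedral_mult dihedral_one dihedral_carrier)

end

section \<open>The nut graphs\<close>

text \<open>Reflections are involutions, so closure under inverses constrains only \<open>R\<close>.
  Equal cardinalities make the vector with 1 on rotations and -1 on reflections a null vector, and
  \<open>ker\<close> leaves only its multiples.\<close>

lemma dihedral_nut_graph:
  fixes m k :: nat and R F :: "int set"
  assumes "m > 0" and fin: "finite R" "finite F"
    and inj: "inj_on (\<lambda>s. s mod int m) R" "inj_on (\<lambda>s. s mod int m) F"
    and card: "card R = k" "card F = k"
    and nz: "\<And>r. r \<in> R \<Longrightarrow> \<not> int m dvd r"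
    and sym: "\<And>r. r \<in> R \<Longrightarrow> \<exists>r'\<in>R. int m dvd r + r'"
    and ker: "alternating_kernel (int m) R F"
  shows "\<exists>G :: nat pair_pre_digraph.
    card (pverts G) = 2 * m \<and> regular_graph (2 * k) G \<and> is_cayley_graph G \<and> nut_graph G"
proof -
  define e where "e = dihedral_elem m"
  note [simp] = dihedral_mult[OF \<open>m > 0\<close>, folded e_def] dihedral_elem_eq_iff[OF \<open>m > 0\<close>, folded e_def]
    dihedral_inv[OF \<open>m > 0\<close>, folded e_def] dihedral_one[OF \<open>m > 0\<close>, folded e_def]
    dihedral_carrier[OF \<open>m > 0\<close>, folded e_def]
  interpret group "dihedral m" by (rule group_dihedral[OF \<open>m > 0\<close>])
  let ?D = "dihedral m"
  define S where "S = (\<lambda>r. e r False) ` R \<union> (\<lambda>f. e f True) ` F"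
  have S: "S \<subseteq> carrier ?D" by (auto simp: S_def)
  have one: "\<one>\<^bsub>?D\<^esub> \<notin> S" using nz by (auto simp: S_def)
  have inv: "inv\<^bsub>?D\<^esub> s \<in> S" if "s \<in> S" for s
    using that unfolding S_def
  proof
    assume "s \<in> (\<lambda>r. e r False) ` R"
    then obtain r where r: "r \<in> R" "s = e r False" by blast
    with sym obtain r' where r': "r' \<in> R" "int m dvd r + r'" by blast
    then have "int m dvd - r - r'" by (metis dvd_minus_iff minus_add_distrib uminus_add_conv_diff add.commute)
    then have "inv\<^bsub>?D\<^esub> s = e r' False" using r by simp
    then show "inv\<^bsub>?D\<^esub> s \<in> (\<lambda>r. e r False) ` R \<union> (\<lambda>f. e f True) ` F" using r' by blast
  qed auto
  have injS: "inj_on (\<lambda>r. e r b) T" if "inj_on (\<lambda>s. s mod int m) T" for T b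
    using that by (auto simp: inj_on_def mod_eq_dvd_iff)
  have disj: "(\<lambda>r. e r False) ` R \<inter> (\<lambda>f. e f True) ` F = {}" by auto
  have sumS: "(\<Sum>s\<in>S. g s) = (\<Sum>r\<in>R. g (e r False)) + (\<Sum>f\<in>F. g (e f True))" for g :: "nat \<Rightarrow> 'c :: comm_monoid_add"
    unfolding S_def using fin disj
    by (subst sum.union_disjoint) (auto simp: sum.reindex[OF injS[OF inj(1)]] sum.reindex[OF injS[OF inj(2)]])
  have cardS: "card S = 2 * k" using sumS[of "\<lambda>_. 1 :: nat"] card by simp
  define G where "G = cayley_graph ?D S"
  have carrier: "carrier ?D = {..<2 * m}" by (simp add: dihedral_def)
  have pg: "pair_graph G" unfolding G_def
    using pair_graph_cayley_graph[OF _ S one inv] by (simp add: carrier)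
  have verts: "pverts G = {..<2 * m}" by (simp add: G_def cayley_graph_def carrier)
  have reg: "regular_graph (2 * k) G" unfolding G_def
    using regular_graph_cayley_graph[OF _ S one inv] cardS by (simp add: carrier)
  have cay: "is_cayley_graph G" unfolding is_cayley_graph_def
    using S one inv group_axioms by (intro exI[of _ ?D] exI[of _ S]) (simp add: G_def carrier)
  \<comment> \<open>Multiplying r^a s by a rotation on the right subtracts the exponent, which is
    where the reversed shifts come from.\<close>
  have row: "(\<Sum>j\<in>{j. j < 2 * m \<and> (e a b, j) \<in> parcs G}. v j)
    = (\<Sum>r\<in>R. v (e (if b then a - r else a + r) b)) + (\<Sum>f\<in>F. v (e (if b then a - f else a + f) (\<not> b)))"
    for a b and v :: "nat \<Rightarrow> real"
  proof -
    have ea: "e a b \<in> carrier ?D" by simp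
    have "{j. j < 2 * m \<and> (e a b, j) \<in> parcs G} = {y \<in> carrier ?D. inv\<^bsub>?D\<^esub> (e a b) \<otimes>\<^bsub>?D\<^esub> y \<in> S}"
      using ea by (auto simp: G_def cayley_graph_def carrier)
    then have "(\<Sum>j\<in>{j. j < 2 * m \<and> (e a b, j) \<in> parcs G}. v j) = (\<Sum>s\<in>S. v (e a b \<otimes>\<^bsub>?D\<^esub> s))"
      using cayley_neighbours[OF S ea] by (simp add: sum.reindex)
    then show ?thesis by (simp add: sumS)
  qed
  have self: "e (int i) (m \<le> i) = i" if "i < 2 * m" for i
    using dihedral_elem_self[OF \<open>m > 0\<close> that] by (simp add: e_def)
  define x :: "nat \<Rightarrow> real" where "x i = (if m \<le> i then - 1 else 1)" for i
  have xe: "x (e a b) = (if b then - 1 else 1)" for a b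
    using dihedral_elem_ge_iff[OF \<open>m > 0\<close>] by (simp add: x_def e_def)
  have "nut_graph G"
  proof (rule nut_graphI[OF pg verts, of x])
    show "2 \<le> 2 * m" using \<open>m > 0\<close> by simp
    show "x i \<noteq> 0" for i by (simp add: x_def)
    fix v :: "nat \<Rightarrow> real"
    show "(\<forall>i<2 * m. (\<Sum>j\<in>{j. j < 2 * m \<and> (i, j) \<in> parcs G}. v j) = 0) \<longleftrightarrow>
      (\<exists>c. \<forall>i<2 * m. v i = c * x i)" (is "?L \<longleftrightarrow> ?R")
    proof
      assume L: ?L
      have "e a b < 2 * m" for a b using dihedral_elem_less[OF \<open>m > 0\<close>] by (simp add: e_def)
      with L have zero:
        "(\<Sum>r\<in>R. v (e (a + r) False)) + (\<Sum>f\<in>F. v (e (a + f) True)) = 0"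
        "(\<Sum>f\<in>F. v (e (a - f) False)) + (\<Sum>r\<in>R. v (e (a - r) True)) = 0" for a
        using row[of v a False] row[of v a True] by (simp_all add: add.commute)
      have per: "e (a + int m) b = e a b" for a b by simp
      have "\<exists>c. \<forall>i. v (e i False) = c \<and> v (e i True) = - c"
        using ker[unfolded alternating_kernel_def, rule_format, of "\<lambda>i. v (e i False)" "\<lambda>i. v (e i True)"]
          per zero by simp
      then obtain c where c: "v (e i False) = c" "v (e i True) = - c" for i by blast
      have "v i = c * x i" if "i < 2 * m" for i
        using c[of "int i"] self[OF that] by (cases "m \<le> i") (auto simp: x_def)
      then show ?R by blast
    next
      assume ?R
      then obtain c where c: "\<And>i. i < 2 * m \<Longrightarrow> v i = c * x i" by blast
      have ve: "v (e a b) = c * (if b then - 1 else 1)" for a b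
        using c[of "e a b"] dihedral_elem_less[OF \<open>m > 0\<close>] by (simp add: e_def[symmetric] xe)
      have "(\<Sum>j\<in>{j. j < 2 * m \<and> (e a b, j) \<in> parcs G}. v j) = 0" for a b
        unfolding row ve using card by simp
      then show ?L using self by metis
    qed
  qed
  moreover have "card (pverts G) = 2 * m" by (simp add: verts)
  ultimately show ?thesis using reg cay by blast
qed

section \<open>Explicit connection sets, represented in a window of \<open>m\<close> consecutive
  integers\<close>

lemma inj_on_mod_window:
  fixes m :: int
  assumes "T \<subseteq> {l..<l + m}"
  shows "inj_on (\<lambda>s. s mod m) T"
proof (rule inj_onI)
  fix s t assume st: "s \<in> T" "t \<in> T" "s mod m = t mod m"
  then have "m dvd s - t" by (simp add: mod_eq_dvd_iff)
  moreover have "s \<in> {l..<l + m}" "t \<in> {l..<l + m}" using st(1,2) assms by blast+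
  then have "\<bar>s - t\<bar> < m" by auto
  ultimately show "s = t" using dvd_imp_le_int[of "s - t" m] by fastforce
qed

lemma card_punctured_interval: "card ({- int p..int p} - {0}) = 2 * p"
  by simp

lemma dihedral_nut_graph_odd:
  assumes "odd m" "q > 0" "m \<ge> 2 * q + 2"
  shows "\<exists>G :: nat pair_pre_digraph.
    card (pverts G) = 2 * m \<and> regular_graph (4 * q) G \<and> is_cayley_graph G \<and> nut_graph G"
proof -
  define e where "e = (int m - 3) div 2"
  have m: "int m = 2 * e + 3" using \<open>odd m\<close> unfolding e_def by presburger
  \<comment> \<open>Oddness of \<open>m\<close> sharpens the bound to
    \<open>m \<ge> 2 * q + 3\<close>; this keeps \<open>Y\<close>, which ends at
    \<open>q - 1\<close>, away from \<open>e\<close>.\<close>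
  have e: "e \<ge> int q" using assms(3) m by linarith
  define y where "y = q - 1"
  have y: "q = Suc y" using \<open>q > 0\<close> by (simp add: y_def)
  define Y where "Y = {- int y..int y} - {0}"
  have Y: "finite Y" "card Y = 2 * y" unfolding Y_def by (simp, rule card_punctured_interval)
  have disj: "Y \<inter> {e, - e, e + 1, - (e + 1)} = {}" using e y by (auto simp: Y_def)
  have ker: "alternating_kernel (int m) (Y \<union> {e + 1, - (e + 1)}) (Y \<union> {e, - e})"
    by (rule alternating_kernel_odd[OF _ m Y(1) _ disj]) (use e y in \<open>auto simp: Y_def\<close>)
  let ?R = "Y \<union> {e + 1, - (e + 1)}" and ?F = "Y \<union> {e, - e}"
  \<comment> \<open>The window runs from \<open>- (e + 1)\<close> to \<open>e + 1\<close>, exactly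
    \<open>m\<close> integers.\<close>
  have sub: "?R \<subseteq> {- (e + 1)..<- (e + 1) + int m}" "?F \<subseteq> {- (e + 1)..<- (e + 1) + int m}"
    using e y m by (auto simp: Y_def)
  have "\<exists>G :: nat pair_pre_digraph.
    card (pverts G) = 2 * m \<and> regular_graph (2 * (2 * q)) G \<and> is_cayley_graph G \<and> nut_graph G"
  proof (rule dihedral_nut_graph[OF _ _ _ inj_on_mod_window[OF sub(1)] inj_on_mod_window[OF sub(2)] _ _ _ _ ker])
    have "card ?R = card Y + card {e + 1, - (e + 1)}" "card ?F = card Y + card {e, - e}"
      using disj Y(1) by (subst card_Un_disjoint; simp)+
    then show "card ?R = 2 * q" "card ?F = 2 * q" using Y(2) e y by simp_all
    show "\<not> int m dvd r" if "r \<in> ?R" for r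
    proof
      assume "int m dvd r"
      moreover have "r \<noteq> 0" "\<bar>r\<bar> < int m" using that e y m by (auto simp: Y_def)
      ultimately show False using dvd_imp_le_int[of r "int m"] by simp
    qed
    show "\<exists>r'\<in>?R. int m dvd r + r'" if "r \<in> ?R" for r
      by (rule bexI[of _ "- r"]) (use that in \<open>auto simp: Y_def\<close>)
  qed (use Y m e in auto)
  then show ?thesis by simp
qed

lemma dihedral_nut_graph_twice_odd:
  assumes "m = 2 * h" "odd h" "q > 0" "m \<ge> 2 * q + 2"
  shows "\<exists>G :: nat pair_pre_digraph.
    card (pverts G) = 2 * m \<and> regular_graph (4 * q) G \<and> is_cayley_graph G \<and> nut_graph G"
proof -
  have m: "int m = 2 * int h" and h: "q < h" using assms by auto
  \<comment> \<open>Omitting 0 and both units leaves room for the pairs \<open>1, - 1\<close> and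
    \<open>0, h\<close>, and makes the size \<open>2 * q - 2\<close>, an even number.\<close>
  define Y where "Y = {- int q..int q} - {- 1, 0, 1}"
  have Y: "finite Y" "card Y = 2 * q - 2"
  proof -
    have "card Y = card {- int q..int q} - card {- 1, 0, 1 :: int}"
      unfolding Y_def using \<open>q > 0\<close> by (subst card_Diff_subset) auto
    then show "card Y = 2 * q - 2" by simp
  qed (simp add: Y_def)
  have disj: "Y \<inter> {0, int h, 1, - 1} = {}" using h by (auto simp: Y_def)
  let ?R = "Y \<union> {1, - 1}" and ?F = "Y \<union> {0, int h}"
  have ker: "alternating_kernel (int m) ?R ?F"
    by (rule alternating_kernel_twice_odd[OF _ _ m Y(1) _ _ disj])
      (use h \<open>q > 0\<close> \<open>odd h\<close> Y(2) in \<open>auto simp: Y_def\<close>)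
  have sub: "?R \<subseteq> {1 - int h..<1 - int h + int m}" "?F \<subseteq> {1 - int h..<1 - int h + int m}"
    using h \<open>q > 0\<close> m by (auto simp: Y_def)
  have "\<exists>G :: nat pair_pre_digraph.
    card (pverts G) = 2 * m \<and> regular_graph (2 * (2 * q)) G \<and> is_cayley_graph G \<and> nut_graph G"
  proof (rule dihedral_nut_graph[OF _ _ _ inj_on_mod_window[OF sub(1)] inj_on_mod_window[OF sub(2)] _ _ _ _ ker])
    have "card ?R = card Y + card {1, - 1 :: int}" "card ?F = card Y + card {0, int h}"
      using disj Y(1) by (subst card_Un_disjoint; simp)+
    then show "card ?R = 2 * q" "card ?F = 2 * q" using Y(2) h \<open>q > 0\<close> by simp_all
    show "\<not> int m dvd r" if "r \<in> ?R" for r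
    proof
      assume "int m dvd r"
      moreover have "r \<noteq> 0" "\<bar>r\<bar> < int m" using that h \<open>q > 0\<close> m by (auto simp: Y_def)
      ultimately show False using dvd_imp_le_int[of r "int m"] by simp
    qed
    show "\<exists>r'\<in>?R. int m dvd r + r'" if "r \<in> ?R" for r
      by (rule bexI[of _ "- r"]) (use that in \<open>auto simp: Y_def\<close>)
  qed (use Y h assms in auto)
  then show ?thesis by simp
qed

text \<open>Degree 4 is separate: the lifted construction would need a one-element \<open>P\<close>
  that contains 1 and is symmetric modulo \<open>m div 2\<close>, which is impossible unless
  \<open>m = 4\<close>.\<close>

lemma dihedral_nut_graph_quarter:
  assumes "m = 4 * h" "h > 0"
  shows "\<exists>G :: nat pair_pre_digraph.
    card (pverts G) = 2 * m \<and> regular_graph 4 G \<and> is_cayley_graph G \<and> nut_graph G"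
proof -
  have m: "int m = 4 * int h" using assms by simp
  let ?R = "{int h, 3 * int h}" and ?F = "{0, 1 :: int}"
  have ker: "alternating_kernel (int m) ?R ?F"
    using assms m by (intro alternating_kernel_quarter) auto
  have sub: "?R \<subseteq> {0..<0 + int m}" "?F \<subseteq> {0..<0 + int m}" using assms m by auto
  have "\<exists>G :: nat pair_pre_digraph.
    card (pverts G) = 2 * m \<and> regular_graph (2 * 2) G \<and> is_cayley_graph G \<and> nut_graph G"
  proof (rule dihedral_nut_graph[OF _ _ _ inj_on_mod_window[OF sub(1)] inj_on_mod_window[OF sub(2)] _ _ _ _ ker])
    show "\<not> int m dvd r" if "r \<in> ?R" for r
    proof
      assume "int m dvd r"
      moreover have "r \<noteq> 0" "\<bar>r\<bar> < int m" using that assms m by auto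
      ultimately show False using dvd_imp_le_int[of r "int m"] by simp
    qed
    show "\<exists>r'\<in>?R. int m dvd r + r'" if "r \<in> ?R" for r
      by (rule bexI[of _ "int m - r"]) (use that m in auto)
  qed (use assms in auto)
  then show ?thesis by simp
qed

lemma dihedral_nut_graph_four_dvd:
  assumes "m = 4 * l" "q \<ge> 2" "m \<ge> 2 * q + 2"
  shows "\<exists>G :: nat pair_pre_digraph.
    card (pverts G) = 2 * m \<and> regular_graph (4 * q) G \<and> is_cayley_graph G \<and> nut_graph G"
proof -
  define p where "p = q div 2"
  define h where "h = 2 * int l"
  have m: "int m = 2 * h" and p: "p > 0" "p < l" using assms by (auto simp: h_def p_def)
  define Y where "Y = {- int p..int p} - {0}"
  \<comment> \<open>When \<open>q\<close> is odd one self-inverse residue modulo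
    \<open>h = 2 * l\<close> is added, namely \<open>l\<close>.\<close>
  define Z where "Z = (if odd q then {int l} else {})"
  define P where "P = Y \<union> Z"
  have Y: "finite Y" "card Y = 2 * p" unfolding Y_def by (simp, rule card_punctured_interval)
  have Z: "finite Z" "card Z = q mod 2" by (auto simp: Z_def odd_iff_mod_2_eq_one)
  have YZ: "Y \<inter> Z = {}" using p by (auto simp: Y_def Z_def)
  have P: "finite P" "card P = q" unfolding P_def
    using Y Z YZ by (auto simp: card_Un_disjoint p_def)
  \<comment> \<open>\<open>P\<close> lies in a window of length \<open>h\<close>, so its translate
    by \<open>h\<close> is disjoint from it and both fit into one window of length
    \<open>m\<close>.\<close>
  have P_bound: "- int l < s" "s \<le> int l" if "s \<in> P" for s
    using that p by (auto simp: P_def Y_def Z_def split: if_splits)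
  have zero: "0 \<notin> P" using p by (auto simp: P_def Y_def Z_def)
  have one: "1 \<in> P" using p by (auto simp: P_def Y_def)
  let ?H = "(\<lambda>s. s + h) ` P"
  let ?R = "P \<union> ?H" and ?F = "insert 0 (P \<union> ?H) - {1}"
  have disj: "P \<inter> ?H = {}"
  proof -
    have False if "s \<in> P" "t \<in> P" "s = t + h" for s t
      using P_bound(2)[OF that(1)] P_bound(1)[OF that(2)] that(3) by (simp add: h_def)
    then show ?thesis by blast
  qed
  have ker: "alternating_kernel (int m) ?R ?F"
  proof (rule alternating_kernel_lifted[OF _ m P(1) one zero _ disj])
    show "h > 0" using p by (simp add: h_def)
    show "- h \<notin> P" using P_bound(1)[of "- h"] by (auto simp: h_def)
    fix g :: "int \<Rightarrow> real" and i
    assume per: "\<And>j. g (j + h) = g j"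
    have "(\<Sum>s\<in>Y. g (i - s)) = (\<Sum>s\<in>Y. g (i + s))" by (rule sum_symmetric) (auto simp: Y_def)
    moreover have "g (i - int l) = g (i + int l)" using per[of "i - int l"] by (simp add: h_def add.commute)
    then have "(\<Sum>s\<in>Z. g (i - s)) = (\<Sum>s\<in>Z. g (i + s))" by (simp add: Z_def)
    ultimately show "(\<Sum>s\<in>P. g (i - s)) = (\<Sum>s\<in>P. g (i + s))"
      unfolding P_def using Y(1) Z(1) YZ by (simp add: sum.union_disjoint)
  qed
  have subR: "?R \<subseteq> {1 - int l..<1 - int l + int m}"
    using P_bound m by (force simp: h_def)
  have subF: "?F \<subseteq> {1 - int l..<1 - int l + int m}"
    using subR p m by (auto simp: h_def)
  have "\<exists>G :: nat pair_pre_digraph.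
    card (pverts G) = 2 * m \<and> regular_graph (2 * (2 * q)) G \<and> is_cayley_graph G \<and> nut_graph G"
  proof (rule dihedral_nut_graph[OF _ _ _ inj_on_mod_window[OF subR] inj_on_mod_window[OF subF] _ _ _ _ ker])
    have "card ?H = card P" by (rule card_image) simp
    then show cR: "card ?R = 2 * q" using disj P by (simp add: card_Un_disjoint)
    have zR: "0 \<notin> ?R" using zero P_bound(1)[of "- h"] by (auto simp: h_def add_eq_0_iff2)
    show "card ?F = 2 * q"
      using cR zR one P(1) by (subst card_Diff_singleton) auto
    show "\<not> int m dvd r" if r: "r \<in> ?R" for r
    proof
      assume "int m dvd r"
      moreover have "r \<noteq> 0" using r zR by blast
      moreover have "\<bar>r\<bar> < int m" using r subR p m by (force simp: h_def)
      ultimately show False using dvd_imp_le_int[of r "int m"] by simp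
    qed
    \<comment> \<open>Inverses exist in \<open>P\<close> only modulo \<open>h\<close>; an error of
      \<open>h\<close> is repaired by passing to the other copy of \<open>P\<close>.\<close>
    have symP: "\<exists>t\<in>P. s + t = 0 \<or> s + t = h" if "s \<in> P" for s
    proof (cases "s \<in> Y")
      case True
      then have "- s \<in> P" by (auto simp: P_def Y_def)
      then show ?thesis by (intro bexI[of _ "- s"]) auto
    next
      case False
      then have "s = int l" using that by (auto simp: P_def Z_def split: if_splits)
      then show ?thesis using that by (intro bexI[of _ s]) (auto simp: h_def)
    qed
    show "\<exists>r'\<in>?R. int m dvd r + r'" if r: "r \<in> ?R" for r
    proof (cases "r \<in> P")
      case True
      then obtain t where t: "t \<in> P" "r + t = 0 \<or> r + t = h" using symP by blast
      show ?thesis using t(2)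
      proof
        assume "r + t = 0"
        then show ?thesis using t by (intro bexI[of _ t]) auto
      next
        assume "r + t = h"
        then show ?thesis using t by (intro bexI[of _ "t + h"]) (auto simp: m)
      qed
    next
      case False
      then obtain s where s: "s \<in> P" "r = s + h" using r by blast
      then obtain t where t: "t \<in> P" "s + t = 0 \<or> s + t = h" using symP by blast
      show ?thesis using t(2)
      proof
        assume "s + t = 0"
        then show ?thesis using t s by (intro bexI[of _ "t + h"]) (auto simp: m)
      next
        assume "s + t = h"
        then have "r + t = int m" using s m by simp
        then show ?thesis using t by (intro bexI[of _ t]) auto
      qed
    qed
  qed (use P assms in auto)
  then show ?thesis by simp
qed

theorem theorem6:
  fixes d n :: nat
  assumes "d > 0" and "4 dvd d" and "even n" and "n \<ge> d + 4"
  shows "\<exists>G :: nat pair_pre_digraph.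
           card (pverts G) = n \<and> regular_graph d G \<and> is_cayley_graph G \<and> nut_graph G"
proof -
  obtain q where d: "d = 4 * q" using \<open>4 dvd d\<close> by blast
  obtain m where n: "n = 2 * m" using \<open>even n\<close> by blast
  have q: "q > 0" and mq: "m \<ge> 2 * q + 2" using assms d n by auto
  consider "odd m" | h where "m = 2 * h" "odd h" | l where "m = 4 * l" "q = 1" | l where "m = 4 * l" "q \<ge> 2"
  proof (cases "odd m")
    case False
    then obtain h where h: "m = 2 * h" by blast
    show ?thesis
    proof (cases "odd h")
      case False
      then obtain l where "m = 4 * l" using h by auto
      moreover have "q = 1 \<or> q \<ge> 2" using q by linarith
      ultimately show ?thesis using that(3,4) by blast
    qed (use that(2) h in blast)
  qed (use that(1) in blast)
  then show ?thesis
  proof cases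
    case 1
    then show ?thesis using dihedral_nut_graph_odd[of m q] q mq d n by simp
  next
    case 2
    then show ?thesis using dihedral_nut_graph_twice_odd[of m _ q] q mq d n by simp
  next
    case (3 l)
    then have "l > 0" using mq by simp
    then show ?thesis using dihedral_nut_graph_quarter[of m l] 3 d n by simp
  next
    case 4
    then show ?thesis using dihedral_nut_graph_four_dvd[of m _ q] mq d n by simp
  qed
qed

end
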